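(* There exist a pre-associative algebra $A$ over $\Bbbk$ (with operations $(x,y)\mapsto x*y$ and $(x,y)\mapsto xy$) and a formal distribution $a(z)\in A[[z,z^{-1}]]$ such that the pair $(a(z),a(z))$ is both $*$-local and $\succ$-local, but the pair $(a(z),\,(a\,{}_{(0)}\,a)(z))$ is not $*$-local, and the pair $((a\,{}_{(0)}\,a)(z),\,a(z))$ is neither $*$-local nor $\succ$-local.
   Context: $\Bbbk$ is a field of characteristic zero and $\mathbb Z_+$ is the set of non-negative integers. A pre-associative (dendriform) algebra is a $\Bbbk$-linear space $A$ with two bilinear operations $(x,y)\mapsto x*y$ and $(x,y)\mapsto xy$ such that for all $x,y,z\in A$: $$(x*y)*z=x*(y*z),\qquad (x*y)z=x(yz),\qquad x(y*z)=(xy)*z+x(yz)-(xy)z.$$ (In terms of the usual dendriform operations, $x*y=x\prec y+x\succ y$ and $xy=x\succ y$.) A formal distribution over $A$ is a two-sided infinite formal series $a(z)=\sum_{n\in\mathbb Z}a_nz^{-n-1}$ with $a_n\in A$; the space of these is $A[[z,z^{-1}]]$. For formal distributions $a(z),b(z)$ put $a(w)*b(z)=\sum_{n,m\in\mathbb Z}(a_n*b_m)w^{-n-1}z^{-m-1}$ and $a(w)b(z)=\sum_{n,m\in\mathbb Z}(a_nb_m)w^{-n-1}z^{-m-1}$ in $A[[w,w^{-1},z,z^{-1}]]$. The ordered pair $(a(z),b(z))$ is $*$-local if there is $N\in\mathbb Z_+$ with $a(w)*b(z)\,(w-z)^N=0$, and $\succ$-local if there is $N\in\mathbb Z_+$ with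 $a(w)b(z)\,(w-z)^N=0$. For $n\in\mathbb Z_+$, $(a\,{}_{(n)}\,b)(z)=\mathrm{Res}_{w=0}\,a(w)b(z)(w-z)^n$ (formed with the second operation $xy$), where $\mathrm{Res}_{w=0}$ is the coefficient at $w^{-1}$. In particular, the coefficient of $z^{-m-1}$ in $(a\,{}_{(0)}\,a)(z)$ is $a_0a_m$. *)

theory Defs
  imports Complex_Main "HOL-Library.Poly_Mapping"
begin

locale preassociative_algebra =
  vector_space scale
  for scale :: "'k::field \<Rightarrow> 'v::ab_group_add \<Rightarrow> 'v" +
  fixes star :: "'v \<Rightarrow> 'v \<Rightarrow> 'v"  (infixl "\<star>" 70)
    and prod :: "'v \<Rightarrow> 'v \<Rightarrow> 'v"  (infixl "\<cdot>" 70)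
  assumes star_linear_left: "Vector_Spaces.linear scale scale (\<lambda>x. x \<star> y)"
    and star_linear_right: "Vector_Spaces.linear scale scale (\<lambda>y. x \<star> y)"
    and prod_linear_left: "Vector_Spaces.linear scale scale (\<lambda>x. x \<cdot> y)"
    and prod_linear_right: "Vector_Spaces.linear scale scale (\<lambda>y. x \<cdot> y)"
    and star_assoc: "(x \<star> y) \<star> z = x \<star> (y \<star> z)"
    and star_prod: "(x \<star> y) \<cdot> z = x \<cdot> (y \<cdot> z)"
    and prod_star: "x \<cdot> (y \<star> z) = (x \<cdot> y) \<star> z + x \<cdot> (y \<cdot> z) - (x \<cdot> y) \<cdot> z"

text \<open>
  A formal distribution is the family of its coefficients: \<open>a n\<close> is the coefficient of
  \<open>z\<close> to the power \<open>- n - 1\<close>.  Likewise, for a series \<open>f\<close> in the two variables \<open>w\<close> and \<open>z\<close>,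
  \<open>f n m\<close> is the coefficient of the monomial with exponent \<open>- n - 1\<close> in \<open>w\<close> and
  \<open>- m - 1\<close> in \<open>z\<close>.
\<close>

type_synonym 'v distribution = "int \<Rightarrow> 'v"
type_synonym 'v distribution2 = "int \<Rightarrow> int \<Rightarrow> 'v"

text \<open>The series \<open>a(w) b(z)\<close>, formed with the given operation on coefficients.\<close>

definition outer_product ::
  "('v \<Rightarrow> 'v \<Rightarrow> 'v) \<Rightarrow> 'v distribution \<Rightarrow> 'v distribution \<Rightarrow> 'v distribution2" where
  "outer_product mul a b = (\<lambda>n m. mul (a n) (b m))"

text \<open>Multiplication by a variable raises its exponent, so it shifts the index by one:
  the coefficient at \<open>n\<close> of the product is the coefficient at \<open>n + 1\<close> of the factor.\<close>

definition mult_w :: "'v distribution2 \<Rightarrow> 'v distribution2" where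
  "mult_w f = (\<lambda>n m. f (n + 1) m)"

definition mult_z :: "'v distribution2 \<Rightarrow> 'v distribution2" where
  "mult_z f = (\<lambda>n m. f n (m + 1))"

definition mult_w_minus_z :: "'v::ab_group_add distribution2 \<Rightarrow> 'v distribution2" where
  "mult_w_minus_z f = (\<lambda>n m. mult_w f n m - mult_z f n m)"

definition local_pair ::
  "('v \<Rightarrow> 'v \<Rightarrow> 'v) \<Rightarrow> 'v::ab_group_add distribution \<Rightarrow> 'v distribution \<Rightarrow> bool" where
  "local_pair mul a b \<longleftrightarrow>
    (\<exists>N::nat. (mult_w_minus_z ^^ N) (outer_product mul a b) = (\<lambda>n m. 0))"

text \<open>The coefficient at \<open>w\<close> to the power \<open>- 1\<close> is the one with index \<open>0\<close>.\<close>

definition res_w :: "'v distribution2 \<Rightarrow> 'v distribution" where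
  "res_w f = (\<lambda>m. f 0 m)"

definition nth_product ::
  "('v \<Rightarrow> 'v \<Rightarrow> 'v) \<Rightarrow> nat \<Rightarrow> 'v::ab_group_add distribution \<Rightarrow> 'v distribution \<Rightarrow> 'v distribution" where
  "nth_product mul n a b = res_w ((mult_w_minus_z ^^ n) (outer_product mul a b))"

lemma nth_product_0: "nth_product mul 0 a b m = mul (a 0) (b m)"
  by (simp add: nth_product_def res_w_def outer_product_def)

end

theory Submission imports Defs begin

text \<open>
  The identity \<open>x \<cdot> (y \<star> z) = (x \<cdot> y) \<star> z + x \<cdot> (y \<cdot> z) - (x \<cdot> y) \<cdot> z\<close> relates
  \<open>(x \<cdot> y) \<star> z\<close> to \<open>(x \<cdot> y) \<cdot> z\<close>, but locality of \<open>a\<close> with itself restricts \<open>(a\<^sub>0 \<cdot> a\<^sub>n) \<cdot> a\<^sub>m\<close>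
  only through the inner factor \<open>a\<^sub>0 \<cdot> a\<^sub>n\<close>, and \<open>a\<^sub>n \<star> (a\<^sub>0 \<cdot> a\<^sub>m)\<close> only through \<open>a\<^sub>0 \<cdot> a\<^sub>m\<close>.
  So the dependence of these elements on the outer factor can be chosen freely, as long as
  \<open>(x \<cdot> y) \<star> z = (x \<cdot> y) \<cdot> z\<close> for generators \<open>x\<close>, \<open>y\<close>, \<open>z\<close> and all their triple products
  other than these and \<open>x \<star> (y \<cdot> z)\<close> vanish.

  This needs only four basis vectors: generators \<open>e\<^sub>0\<close>, \<open>e\<^sub>1\<close> of degree 1, \<open>e\<^sub>2\<close> of
  degree 2 and \<open>e\<^sub>3\<close> of degree 3, with the nonzero products
  \<open>e\<^sub>0 \<cdot> e\<^sub>0 = e\<^sub>2\<close>, \<open>e\<^sub>2 \<cdot> e\<^sub>1 = e\<^sub>3\<close>, \<open>e\<^sub>2 \<star> e\<^sub>1 = e\<^sub>3\<close>, \<open>e\<^sub>1 \<star> e\<^sub>2 = e\<^sub>3\<close>.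
  Both operations are graded and there is nothing in degree 4 or higher, so every axiom need
  only be checked on generators; there \<open>\<star>\<close> vanishes, and the axioms reduce to
  \<open>(x \<cdot> y) \<star> z = (x \<cdot> y) \<cdot> z\<close> and
  \<open>x \<cdot> (y \<cdot> z) = 0\<close>.

  Take \<open>a\<^sub>n = e\<^sub>0\<close> for \<open>n \<noteq> 0\<close> and \<open>a\<^sub>0 = e\<^sub>0 + e\<^sub>1\<close>.  Then \<open>a\<^sub>n \<star> a\<^sub>m = 0\<close>, while
  \<open>a\<^sub>n \<cdot> a\<^sub>m = e\<^sub>2\<close> is constant and so is killed by \<open>w - z\<close>.  The coefficients of the
  \<open>0\<close>-th product of \<open>a\<close> with itself are all \<open>e\<^sub>2\<close>, and the product of \<open>e\<^sub>2\<close> with \<open>a\<^sub>m\<close> (in either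
  order for \<open>\<star>\<close>, from the left for \<open>\<cdot>\<close>) is \<open>e\<^sub>3\<close> for \<open>m = 0\<close> and zero otherwise.  Each of the
  three remaining series is therefore \<open>e\<^sub>3\<close> times the product of a
  single power of one variable with the sum of all powers of the other one.  Its leading term
  in the first variable shows that no power of \<open>w - z\<close> annihilates it.
\<close>

text \<open>
  A smallest index \<open>n\<^sub>0\<close> of the left factor means a highest power of \<open>w\<close>; multiplication by
  \<open>(w - z)\<^sup>N\<close> multiplies that leading term by \<open>w\<^sup>N\<close>, so it survives.
\<close>

lemma not_local_pair_if_least_left_index:
  fixes mul :: "'v \<Rightarrow> 'v \<Rightarrow> 'v::ab_group_add"
  assumes least: "\<And>m. mul (a n\<^sub>0) (b m) \<noteq> 0"
    and below: "\<And>n m. n < n\<^sub>0 \<Longrightarrow> mul (a n) (b m) = 0"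
  shows "\<not> local_pair mul a b"
proof -
  let ?g = "\<lambda>N. (mult_w_minus_z ^^ N) (outer_product mul a b)"
  have "(\<forall>m. ?g N (n\<^sub>0 - int N) m \<noteq> 0) \<and> (\<forall>n m. n < n\<^sub>0 - int N \<longrightarrow> ?g N n m = 0)" for N
  proof (induction N)
    case 0
    then show ?case using least below by (simp add: outer_product_def)
  next
    case (Suc N)
    have "?g (Suc N) n m = ?g N (n + 1) m - ?g N n (m + 1)" for n m
      by (simp add: mult_w_minus_z_def mult_w_def mult_z_def)
    with Suc show ?case by simp
  qed
  then show ?thesis unfolding local_pair_def by metis
qed

text \<open>The same argument with the leading power of \<open>z\<close>, which \<open>(w - z)\<^sup>N\<close> multiplies by \<open>(- z)\<^sup>N\<close>.\<close>

lemma not_local_pair_if_least_right_index: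
  fixes mul :: "'v \<Rightarrow> 'v \<Rightarrow> 'v::ab_group_add"
  assumes least: "\<And>n. mul (a n) (b m\<^sub>0) \<noteq> 0"
    and below: "\<And>n m. m < m\<^sub>0 \<Longrightarrow> mul (a n) (b m) = 0"
  shows "\<not> local_pair mul a b"
proof -
  let ?g = "\<lambda>N. (mult_w_minus_z ^^ N) (outer_product mul a b)"
  have "(\<forall>n. ?g N n (m\<^sub>0 - int N) \<noteq> 0) \<and> (\<forall>n m. m < m\<^sub>0 - int N \<longrightarrow> ?g N n m = 0)" for N
  proof (induction N)
    case 0
    then show ?case using least below by (simp add: outer_product_def)
  next
    case (Suc N)
    have "?g (Suc N) n m = ?g N (n + 1) m - ?g N n (m + 1)" for n m
      by (simp add: mult_w_minus_z_def mult_w_def mult_z_def)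
    with Suc show ?case by simp
  qed
  then show ?thesis unfolding local_pair_def by metis
qed

lemma local_pair_if_zero:
  assumes "\<And>n m. mul (a n) (b m) = 0"
  shows "local_pair mul a b"
  unfolding local_pair_def
  by (rule exI[of _ 0]) (simp add: outer_product_def assms)

lemma local_pair_if_constant:
  assumes "\<And>n m. mul (a n) (b m) = c"
  shows "local_pair mul a b"
  unfolding local_pair_def
  by (rule exI[of _ 1])
    (simp add: outer_product_def mult_w_minus_z_def mult_w_def mult_z_def assms)

abbreviation lookup :: "(nat \<Rightarrow>\<^sub>0 'k::zero) \<Rightarrow> nat \<Rightarrow> 'k" where
  "lookup \<equiv> Poly_Mapping.lookup"

definition coeff_scale :: "'k::field \<Rightarrow> (nat \<Rightarrow>\<^sub>0 'k) \<Rightarrow> (nat \<Rightarrow>\<^sub>0 'k)" where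
  "coeff_scale r p = Poly_Mapping.map ((*) r) p"

text \<open>
  The multiplication table above, extended bilinearly; the basis vectors with index above 3
  multiply to zero with everything.
\<close>

definition ex_prod :: "(nat \<Rightarrow>\<^sub>0 'k::field) \<Rightarrow> (nat \<Rightarrow>\<^sub>0 'k) \<Rightarrow> (nat \<Rightarrow>\<^sub>0 'k)" where
  "ex_prod p q =
    Poly_Mapping.single 2 (lookup p 0 * lookup q 0) +
    Poly_Mapping.single 3 (lookup p 2 * lookup q 1)"

definition ex_star :: "(nat \<Rightarrow>\<^sub>0 'k::field) \<Rightarrow> (nat \<Rightarrow>\<^sub>0 'k) \<Rightarrow> (nat \<Rightarrow>\<^sub>0 'k)" where
  "ex_star p q =
    Poly_Mapping.single 3 (lookup p 2 * lookup q 1 + lookup p 1 * lookup q 2)"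

definition ex_dist :: "(nat \<Rightarrow>\<^sub>0 'k::field) distribution" where
  "ex_dist n = Poly_Mapping.single 0 1 + (if n = 0 then Poly_Mapping.single 1 1 else 0)"

lemma lookup_coeff_scale [simp]: "lookup (coeff_scale r p) i = r * lookup p i"
  by (simp add: coeff_scale_def map.rep_eq when_def)

lemma lookup_ex_prod [simp]:
  "lookup (ex_prod p q) i =
    (if i = 2 then lookup p 0 * lookup q 0 else if i = 3 then lookup p 2 * lookup q 1 else 0)"
  by (simp add: ex_prod_def lookup_add lookup_single when_def)

lemma lookup_ex_star [simp]:
  "lookup (ex_star p q) i =
    (if i = 3 then lookup p 2 * lookup q 1 + lookup p 1 * lookup q 2 else 0)"
  by (simp add: ex_star_def lookup_single when_def)

lemma lookup_ex_dist [simp]: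
  "lookup (ex_dist n) i = (if i = 0 \<or> i = 1 \<and> n = 0 then 1 else 0)"
  by (simp add: ex_dist_def lookup_add lookup_single lookup_one when_def)

lemma vector_space_coeff_scale: "vector_space coeff_scale"
  by unfold_locales (auto intro!: poly_mapping_eqI simp: lookup_add algebra_simps)

lemma preassociative_algebra_ex: "preassociative_algebra coeff_scale ex_star ex_prod"
proof -
  interpret vector_space coeff_scale by (rule vector_space_coeff_scale)
  show ?thesis
    by unfold_locales
      (auto intro!: poly_mapping_eqI simp: lookup_add lookup_minus algebra_simps)
qed

lemma ex_prod_ex_dist: "ex_prod (ex_dist n) (ex_dist m) = Poly_Mapping.single 2 1"
  by (auto intro!: poly_mapping_eqI simp: lookup_single when_def)

lemma ex_star_ex_dist: "ex_star (ex_dist n) (ex_dist m) = 0"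
  by (auto intro!: poly_mapping_eqI)

lemma nth_product_ex_dist:
  "nth_product ex_prod 0 ex_dist ex_dist m = Poly_Mapping.single 2 1"
  by (simp add: nth_product_0 ex_prod_ex_dist)

lemma ex_products_ex_dist_degree_2:
  "ex_star (ex_dist n) (Poly_Mapping.single 2 1) = (if n = 0 then Poly_Mapping.single 3 1 else 0)"
  "ex_star (Poly_Mapping.single 2 1) (ex_dist n) = (if n = 0 then Poly_Mapping.single 3 1 else 0)"
  "ex_prod (Poly_Mapping.single 2 1) (ex_dist n) = (if n = 0 then Poly_Mapping.single 3 1 else 0)"
  by (auto intro!: poly_mapping_eqI simp: lookup_single when_def)

lemma single_one_neq_zero: "Poly_Mapping.single i (1::'a::zero_neq_one) \<noteq> 0"
  by (metis lookup_single_eq lookup_zero zero_neq_one)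

theorem proposition1:
  "\<exists>(scale :: 'k::field_char_0 \<Rightarrow> (nat \<Rightarrow>\<^sub>0 'k) \<Rightarrow> (nat \<Rightarrow>\<^sub>0 'k))
     (star :: (nat \<Rightarrow>\<^sub>0 'k) \<Rightarrow> (nat \<Rightarrow>\<^sub>0 'k) \<Rightarrow> (nat \<Rightarrow>\<^sub>0 'k))
     (prod :: (nat \<Rightarrow>\<^sub>0 'k) \<Rightarrow> (nat \<Rightarrow>\<^sub>0 'k) \<Rightarrow> (nat \<Rightarrow>\<^sub>0 'k))
     (a :: (nat \<Rightarrow>\<^sub>0 'k) distribution).
     preassociative_algebra scale star prod \<and>
     local_pair star a a \<and>
     local_pair prod a a \<and>
     \<not> local_pair star a (nth_product prod 0 a a) \<and>
     \<not> local_pair star (nth_product prod 0 a a) a \<and>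
     \<not> local_pair prod (nth_product prod 0 a a) a"
proof (intro exI conjI)
  show "preassociative_algebra (coeff_scale :: 'k \<Rightarrow> _) ex_star ex_prod"
    by (rule preassociative_algebra_ex)
  show "local_pair ex_star ex_dist (ex_dist :: (nat \<Rightarrow>\<^sub>0 'k) distribution)"
    by (rule local_pair_if_zero) (rule ex_star_ex_dist)
  show "local_pair ex_prod ex_dist (ex_dist :: (nat \<Rightarrow>\<^sub>0 'k) distribution)"
    by (rule local_pair_if_constant) (rule ex_prod_ex_dist)
  let ?b = "nth_product ex_prod 0 ex_dist ex_dist :: (nat \<Rightarrow>\<^sub>0 'k) distribution"
  show "\<not> local_pair ex_star ex_dist ?b"
    by (rule not_local_pair_if_least_left_index[where n\<^sub>0 = 0])
      (simp_all add: nth_product_ex_dist ex_products_ex_dist_degree_2 single_one_neq_zero)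
  show "\<not> local_pair ex_star ?b ex_dist"
    by (rule not_local_pair_if_least_right_index[where m\<^sub>0 = 0])
      (simp_all add: nth_product_ex_dist ex_products_ex_dist_degree_2 single_one_neq_zero)
  show "\<not> local_pair ex_prod ?b ex_dist"
    by (rule not_local_pair_if_least_right_index[where m\<^sub>0 = 0])
      (simp_all add: nth_product_ex_dist ex_products_ex_dist_degree_2 single_one_neq_zero)
qed

end
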